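(* Let $A,B,C,D$ be $n\times n$ Hermitian positive definite matrices, let $\circ$ denote the Hadamard (entrywise) product and $\otimes$ the Kronecker product. Then $$\delta_S^2(A\circ B,\;C\circ D)\le\delta_S^2(A\otimes B,\;C\otimes D).$$
   Context: For Hermitian positive definite $X,Y$ of the same size (any size): $\delta_S^2(X,Y):=\log\det\left(\frac{X+Y}{2}\right)-\frac12\log\det(XY)$. *)

theory Defs
  imports
    "Jordan_Normal_Form.Determinant"
    "Jordan_Normal_Form.Schur_Decomposition"
begin

text \<open>For Hermitian \<open>X\<close> the number \<open>(X *\<^sub>v v) \<bullet>c v\<close> is the quadratic form
  \<open>v\<^sup>* X v\<close>, which is real; hence taking \<open>Re\<close> loses nothing.\<close>

definition hermitian_pd :: "nat \<Rightarrow> complex mat \<Rightarrow> bool" where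
  "hermitian_pd n X \<longleftrightarrow>
     X \<in> carrier_mat n n \<and> mat_adjoint X = X \<and>
     (\<forall>v \<in> carrier_vec n. v \<noteq> 0\<^sub>v n \<longrightarrow> Re ((X *\<^sub>v v) \<bullet>c v) > 0)"

text \<open>Only used for matrices of equal dimensions.\<close>

definition hadamard_prod :: "'a :: times mat \<Rightarrow> 'a mat \<Rightarrow> 'a mat"  (infixl \<open>\<circ>\<^sub>H\<close> 70) where
  "A \<circ>\<^sub>H B = mat (dim_row A) (dim_col A) (\<lambda>(i, j). A $$ (i, j) * B $$ (i, j))"

text \<open>The block matrix whose \<open>(i, j)\<close> block is \<open>A $$ (i, j)\<close> times \<open>B\<close>.\<close>

definition kronecker_prod :: "'a :: times mat \<Rightarrow> 'a mat \<Rightarrow> 'a mat"  (infixl \<open>\<otimes>\<^sub>K\<close> 70) where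
  "A \<otimes>\<^sub>K B = mat (dim_row A * dim_row B) (dim_col A * dim_col B)
     (\<lambda>(i, j). A $$ (i div dim_row B, j div dim_col B) * B $$ (i mod dim_row B, j mod dim_col B))"

text \<open>The square \<open>\<delta>\<^sub>S\<^sup>2(X, Y)\<close> of the S-divergence distance. For Hermitian positive definite
  \<open>X\<close> and \<open>Y\<close> of the same size both determinants are positive reals
  (\<open>det (X * Y) = det X * det Y\<close>, although \<open>X * Y\<close> need not be Hermitian), so that
  \<open>ln \<circ> Re\<close> is the intended real logarithm.\<close>

definition delta_S_sq :: "complex mat \<Rightarrow> complex mat \<Rightarrow> real" where
  "delta_S_sq X Y =
     ln (Re (det ((1/2) \<cdot>\<^sub>m (X + Y)))) - 1/2 * ln (Re (det (X * Y)))"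

end

theory Submission
  imports Defs
begin

text \<open>\<open>A \<circ>\<^sub>H B\<close> is the principal submatrix of \<open>A \<otimes>\<^sub>K B\<close> on the indices \<open>i * n + i\<close>, so it
  suffices that \<open>\<delta>\<^sub>S\<^sup>2\<close> decreases when a single index \<open>k\<close> is deleted. The ratio of \<open>det X\<close> to the
  determinant of the remaining submatrix is the minimum of \<open>v\<^sup>* X v\<close> subject to \<open>v\<^sub>k = 1\<close>, attained
  at the normalised \<open>k\<close>-th column of the adjugate. A minimum of linear functions of \<open>X\<close> is concave,
  so the ratio at \<open>(X + Y) / 2\<close> is at least the arithmetic, hence the geometric, mean of the
  ratios at \<open>X\<close> and \<open>Y\<close>. Taking logarithms yields the claim. Positive definiteness of \<open>A \<otimes>\<^sub>K B\<close>
  is obtained by eliminating the indices of \<open>A\<close> one at a time, each step splitting off a rank-one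
  part and leaving a Schur complement.\<close>

section \<open>Sesquilinear forms and positive definite kernels\<close>

text \<open>This is \<open>d\<^sup>* K c\<close>, taken over an arbitrary index set so that pairs
  can serve as indices for tensor products.\<close>

definition sesq :: "'a set \<Rightarrow> ('a \<Rightarrow> 'a \<Rightarrow> complex) \<Rightarrow> ('a \<Rightarrow> complex) \<Rightarrow> ('a \<Rightarrow> complex) \<Rightarrow> complex" where
  "sesq S K c d = (\<Sum>i\<in>S. \<Sum>j\<in>S. K i j * c j * cnj (d i))"

definition pd_kernel :: "'a set \<Rightarrow> ('a \<Rightarrow> 'a \<Rightarrow> complex) \<Rightarrow> bool" where
  "pd_kernel S K \<longleftrightarrow>
     (\<forall>i\<in>S. \<forall>j\<in>S. cnj (K i j) = K j i) \<and>
     (\<forall>c. (\<exists>i\<in>S. c i \<noteq> 0) \<longrightarrow> Re (sesq S K c c) > 0)"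

lemma pd_kernel_cnj: "pd_kernel S K \<Longrightarrow> i \<in> S \<Longrightarrow> j \<in> S \<Longrightarrow> cnj (K i j) = K j i"
  unfolding pd_kernel_def by blast

lemma pd_kernel_pos: "pd_kernel S K \<Longrightarrow> i \<in> S \<Longrightarrow> c i \<noteq> 0 \<Longrightarrow> Re (sesq S K c c) > 0"
  unfolding pd_kernel_def by blast

lemma pd_kernel_nonneg:
  assumes "pd_kernel S K"
  shows "Re (sesq S K c c) \<ge> 0"
proof (cases "\<exists>i\<in>S. c i \<noteq> 0")
  case True
  then show ?thesis using pd_kernel_pos[OF assms] by (auto intro: less_imp_le)
next
  case False
  then show ?thesis by (simp add: sesq_def)
qed

lemma pd_kernel_cong:
  assumes "pd_kernel S K" and "\<And>i j. i \<in> S \<Longrightarrow> j \<in> S \<Longrightarrow> K i j = L i j"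
  shows "pd_kernel S L"
proof -
  have "sesq S K c c = sesq S L c c" for c
    unfolding sesq_def using assms(2) by (intro sum.cong refl) auto
  with assms show ?thesis unfolding pd_kernel_def by simp
qed

lemma sesq_cnj:
  assumes "pd_kernel S K"
  shows "cnj (sesq S K c d) = sesq S K d c"
proof -
  have "cnj (sesq S K c d) = (\<Sum>i\<in>S. \<Sum>j\<in>S. K j i * d i * cnj (c j))"
    unfolding sesq_def cnj_sum
    by (intro sum.cong refl) (simp add: pd_kernel_cnj[OF assms] mult_ac)
  then show ?thesis
    unfolding sesq_def by (subst sum.swap) simp
qed

lemma sesq_cong:
  assumes "\<And>i. i \<in> S \<Longrightarrow> c i = c' i" and "\<And>i. i \<in> S \<Longrightarrow> d i = d' i"
  shows "sesq S K c d = sesq S K c' d'"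
  unfolding sesq_def using assms by (intro sum.cong refl) auto

lemma sesq_add:
  "sesq S K (\<lambda>i. c i + c' i) (\<lambda>i. d i + d' i) =
     sesq S K c d + sesq S K c' d + sesq S K c d' + sesq S K c' d'"
  unfolding sesq_def sum.distrib[symmetric] by (intro sum.cong refl) (simp add: algebra_simps)

text \<open>A vector on \<open>T\<close> is carried along \<open>f\<close> and extended by zero to
  \<open>S\<close>, which leaves the value of the form unchanged. This covers principal submatrices
  as well as renumberings of indices.\<close>

lemma pd_kernel_reindex:
  assumes pd: "pd_kernel S K" and S: "finite S" and f: "inj_on f T" "f ` T \<subseteq> S"
  shows "pd_kernel T (\<lambda>i j. K (f i) (f j))"
  unfolding pd_kernel_def
proof (intro conjI ballI allI impI)
  fix i j assume "i \<in> T" "j \<in> T"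
  then show "cnj (K (f i) (f j)) = K (f j) (f i)"
    using f(2) by (intro pd_kernel_cnj[OF pd]) auto
next
  fix c :: "'b \<Rightarrow> complex" assume "\<exists>i\<in>T. c i \<noteq> 0"
  then obtain i where i: "i \<in> T" "c i \<noteq> 0" by blast
  define e where "e k = (if k \<in> f ` T then c (the_inv_into T f k) else 0)" for k
  have e: "e (f j) = c j" if "j \<in> T" for j
    using that f(1) by (auto simp: e_def the_inv_into_f_f)
  have "sesq S K e e = sesq (f ` T) K e e"
  proof -
    have e0: "e k = 0" if "k \<notin> f ` T" for k using that by (simp add: e_def)
    have "sesq S K e e = (\<Sum>i\<in>f ` T. \<Sum>j\<in>S. K i j * e j * cnj (e i))"
      unfolding sesq_def by (rule sum.mono_neutral_right[OF S f(2)]) (simp add: e0)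
    also have "\<dots> = sesq (f ` T) K e e"
      unfolding sesq_def
      by (rule sum.cong[OF refl], rule sum.mono_neutral_right[OF S f(2)]) (simp add: e0)
    finally show ?thesis .
  qed
  also have "\<dots> = sesq T (\<lambda>i j. K (f i) (f j)) c c"
    unfolding sesq_def using f(1) by (simp add: sum.reindex e)
  finally have "sesq S K e e = sesq T (\<lambda>i j. K (f i) (f j)) c c" .
  moreover have "Re (sesq S K e e) > 0"
    using i f(2) e pd_kernel_pos[OF pd, of "f i" e] by auto
  ultimately show "Re (sesq T (\<lambda>i j. K (f i) (f j)) c c) > 0" by simp
qed

lemma pd_kernel_diag:
  assumes pd: "pd_kernel S K" and S: "finite S" and p: "p \<in> S"
  shows "Re (K p p) > 0" and "K p p = of_real (Re (K p p))"
proof -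
  \<comment> \<open>Reindexing from a one-point set views the entry at \<open>p\<close> as a 1 by 1
    principal submatrix.\<close>
  have "pd_kernel {()} (\<lambda>_ _. K p p)"
    using pd_kernel_reindex[OF pd S, of "\<lambda>_. p" "{()}"] p by auto
  from pd_kernel_pos[OF this, of "()" "\<lambda>_. 1"] show "Re (K p p) > 0"
    by (simp add: sesq_def)
  show "K p p = of_real (Re (K p p))"
    using pd_kernel_cnj[OF pd p p] by (auto simp: complex_eq_iff)
qed

section \<open>Schur complements\<close>

definition schur_compl :: "('a \<Rightarrow> 'a \<Rightarrow> complex) \<Rightarrow> 'a \<Rightarrow> 'a \<Rightarrow> 'a \<Rightarrow> complex" where
  "schur_compl K p i j = K i j - K i p * K p j / K p p"

text \<open>\<open>G\<close> is left arbitrary so that the identity serves both for \<open>G j i = c j * cnj (c i)\<close>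
  and for the Gram kernel occurring in a tensor product.\<close>

lemma schur_compl_sum:
  assumes pd: "pd_kernel (insert p S) K" and S: "finite S" "p \<notin> S"
  shows "(\<Sum>i\<in>insert p S. \<Sum>j\<in>insert p S. K i j * G j i) =
    (\<Sum>i\<in>insert p S. \<Sum>j\<in>insert p S. K p j * cnj (K p i) * G j i) / K p p +
    (\<Sum>i\<in>S. \<Sum>j\<in>S. schur_compl K p i j * G j i)"
proof -
  let ?T = "insert p S"
  have K0: "K p p \<noteq> 0" using pd_kernel_diag(1)[OF pd, of p] S by auto
  have "(\<Sum>i\<in>?T. \<Sum>j\<in>?T. K i j * G j i) =
    (\<Sum>i\<in>?T. \<Sum>j\<in>?T. K p j * cnj (K p i) * G j i / K p p + schur_compl K p i j * G j i)"
    using pd_kernel_cnj[OF pd, of p] K0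
    by (intro sum.cong refl) (auto simp: schur_compl_def field_simps)
  also have "\<dots> = (\<Sum>i\<in>?T. \<Sum>j\<in>?T. K p j * cnj (K p i) * G j i) / K p p +
      (\<Sum>i\<in>?T. \<Sum>j\<in>?T. schur_compl K p i j * G j i)"
    by (simp only: sum.distrib sum_divide_distrib)
  \<comment> \<open>Row and column \<open>p\<close> of the Schur complement are zero, since the
    pivot \<open>K p p\<close> is nonzero.\<close>
  also have "(\<Sum>i\<in>?T. \<Sum>j\<in>?T. schur_compl K p i j * G j i) =
      (\<Sum>i\<in>S. \<Sum>j\<in>S. schur_compl K p i j * G j i)"
    using S K0 by (simp add: schur_compl_def)
  finally show ?thesis .
qed

text \<open>A vector on \<open>S\<close> extends to \<open>p\<close> so that the rank-one part in
  \<open>schur_compl_sum\<close> vanishes; the form of \<open>K\<close> at the extension is then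
  that of the Schur complement.\<close>

lemma pd_kernel_schur_compl:
  assumes pd: "pd_kernel (insert p S) K" and S: "finite S" "p \<notin> S"
  shows "pd_kernel S (schur_compl K p)"
  unfolding pd_kernel_def
proof (intro conjI ballI allI impI)
  fix i j assume "i \<in> S" "j \<in> S"
  then show "cnj (schur_compl K p i j) = schur_compl K p j i"
    using pd_kernel_cnj[OF pd] by (simp add: schur_compl_def mult.commute)
next
  fix c :: "'a \<Rightarrow> complex" assume "\<exists>i\<in>S. c i \<noteq> 0"
  then obtain i where i: "i \<in> S" "c i \<noteq> 0" by blast
  let ?T = "insert p S"
  have K0: "K p p \<noteq> 0" using pd_kernel_diag(1)[OF pd, of p] S by auto
  \<comment> \<open>The value at \<open>p\<close> is the solution of
    \<open>(\<Sum>j\<in>insert p S. K p j * e j) = 0\<close>.\<close>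
  define e where "e = c(p := - (\<Sum>j\<in>S. K p j * c j) / K p p)"
  have eS: "e j = c j" if "j \<in> S" for j using that S by (auto simp: e_def)
  have y0: "(\<Sum>j\<in>?T. K p j * e j) = 0"
    using S K0 by (simp add: eS) (simp add: e_def)
  have "(\<Sum>i\<in>?T. \<Sum>j\<in>?T. K p j * cnj (K p i) * (e j * cnj (e i))) =
      (\<Sum>i\<in>?T. cnj (K p i) * cnj (e i) * (\<Sum>j\<in>?T. K p j * e j))"
    unfolding sum_distrib_left by (intro sum.cong refl) (simp add: mult_ac)
  also have "\<dots> = 0" by (simp only: y0) simp
  finally have "sesq ?T K e e = sesq S (schur_compl K p) e e"
    using schur_compl_sum[OF assms, of "\<lambda>j i. e j * cnj (e i)"]
    by (simp add: sesq_def mult.assoc)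
  also have "\<dots> = sesq S (schur_compl K p) c c" by (rule sesq_cong) (simp_all add: eS)
  finally have "sesq ?T K e e = sesq S (schur_compl K p) c c" .
  moreover have "Re (sesq ?T K e e) > 0"
    using pd_kernel_pos[OF pd, of i e] i eS by auto
  ultimately show "Re (sesq S (schur_compl K p) c c) > 0" by simp
qed

section \<open>Gram kernels and tensor products\<close>

text \<open>With \<open>a = K p\<close> the right-hand side is the rank-one sum of
  \<open>schur_compl_sum\<close> for a Gram kernel, which thereby becomes a single value of the form
  of \<open>L\<close>.\<close>

lemma sesq_sum:
  shows "sesq T L (\<lambda>k. \<Sum>j\<in>R. a j * V j k) (\<lambda>k. \<Sum>j\<in>R. a j * V j k) =
    (\<Sum>i\<in>R. \<Sum>j\<in>R. a j * cnj (a i) * sesq T L (V j) (V i))"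
proof -
  have "sesq T L (\<lambda>k. \<Sum>j\<in>R. a j * V j k) (\<lambda>k. \<Sum>j\<in>R. a j * V j k) =
     (\<Sum>k\<in>T. \<Sum>l\<in>T. \<Sum>i\<in>R. \<Sum>j\<in>R. a j * cnj (a i) * (L k l * V j l * cnj (V i k)))"
    unfolding sesq_def cnj_sum complex_cnj_mult mult.assoc sum_product
    by (rule sum.cong[OF refl], rule sum.cong[OF refl], subst sum.swap)
      (simp add: sum_distrib_left mult_ac)
  also have "\<dots> = (\<Sum>k\<in>T. \<Sum>i\<in>R. \<Sum>l\<in>T. \<Sum>j\<in>R. a j * cnj (a i) * (L k l * V j l * cnj (V i k)))"
    by (intro sum.cong refl sum.swap)
  also have "\<dots> = (\<Sum>i\<in>R. \<Sum>k\<in>T. \<Sum>l\<in>T. \<Sum>j\<in>R. a j * cnj (a i) * (L k l * V j l * cnj (V i k)))"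
    by (rule sum.swap)
  also have "\<dots> = (\<Sum>i\<in>R. \<Sum>k\<in>T. \<Sum>j\<in>R. \<Sum>l\<in>T. a j * cnj (a i) * (L k l * V j l * cnj (V i k)))"
    by (intro sum.cong refl sum.swap)
  also have "\<dots> = (\<Sum>i\<in>R. \<Sum>j\<in>R. \<Sum>k\<in>T. \<Sum>l\<in>T. a j * cnj (a i) * (L k l * V j l * cnj (V i k)))"
    by (intro sum.cong refl sum.swap)
  finally show ?thesis by (simp add: sesq_def sum_distrib_left)
qed

text \<open>Induction on \<open>S\<close>: removing \<open>p\<close> splits off a nonnegative term,
  a value of the form of \<open>L\<close> divided by the pivot, and leaves the same kind of sum for
  the Schur complement. Hence \<open>K\<close> must vary in the induction.\<close>

lemma pd_kernel_gram_pos: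
  assumes "finite S" and "pd_kernel S K" and L: "pd_kernel T L"
    and "i \<in> S" and k: "k \<in> T" and "V i k \<noteq> 0"
  shows "Re (\<Sum>i\<in>S. \<Sum>j\<in>S. K i j * sesq T L (V j) (V i)) > 0"
  using assms(1,2,4,6) k
proof (induction S arbitrary: K i k rule: finite_induct)
  case (insert p S)
  let ?P = "insert p S"
  define y where "y k = (\<Sum>j\<in>?P. K p j * V j k)" for k
  define r where "r = Re (K p p)"
  have r: "r > 0" "K p p = of_real r"
    unfolding r_def using pd_kernel_diag[OF insert.prems(1), of p] insert.hyps by auto
  let ?Q = "\<Sum>i\<in>S. \<Sum>j\<in>S. schur_compl K p i j * sesq T L (V j) (V i)"
  have pd': "pd_kernel S (schur_compl K p)"
    by (rule pd_kernel_schur_compl[OF insert.prems(1) insert.hyps])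
  have "(\<Sum>i\<in>?P. \<Sum>j\<in>?P. K i j * sesq T L (V j) (V i)) = sesq T L y y / r + ?Q"
    unfolding schur_compl_sum[OF insert.prems(1) insert.hyps] y_def r(2)[symmetric]
    by (simp only: sesq_sum)
  then have eq: "Re (\<Sum>i\<in>?P. \<Sum>j\<in>?P. K i j * sesq T L (V j) (V i)) = Re (sesq T L y y) / r + Re ?Q"
    by simp
  show ?case
  proof (cases "\<exists>i\<in>S. \<exists>k\<in>T. V i k \<noteq> 0")
    case True
    then have "Re ?Q > 0" using insert.IH[OF pd'] by blast
    moreover have "Re (sesq T L y y) / r \<ge> 0" using r pd_kernel_nonneg[OF L] by simp
    ultimately show ?thesis unfolding eq by simp
  next
    \<comment> \<open>All \<open>V i\<close> with \<open>i \<in> S\<close> vanish on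
      \<open>T\<close>, so the remainder is zero. Positivity comes from the rank-one term, as
      \<open>y\<close> is \<open>K p p\<close> times \<open>V p\<close> on \<open>T\<close>.\<close>
    case False
    then have "sesq T L (V j) (V i) = 0" if "i \<in> S" for i j
      using that unfolding sesq_def by (auto intro!: sum.neutral)
    then have Q: "?Q = 0" by simp
    from False insert.prems have "i = p" "V p k \<noteq> 0" by auto
    moreover have "y k = K p p * V p k"
      using False insert.hyps \<open>k \<in> T\<close> by (auto simp: y_def)
    ultimately have "y k \<noteq> 0" using r by simp
    then have "Re (sesq T L y y) > 0" using pd_kernel_pos[OF L \<open>k \<in> T\<close>] by blast
    then show ?thesis unfolding eq Q using r by simp
  qed
qed simp

text \<open>A vector \<open>c\<close> on pairs is read as the family of its rows. Interchanging the
  two middle sums turns the tensor form into a \<open>K\<close>-weighted sum of Gram entries of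
  these rows.\<close>

lemma pd_kernel_tensor:
  assumes S: "finite S" and K: "pd_kernel S K" and L: "pd_kernel T L"
  shows "pd_kernel (S \<times> T) (\<lambda>p q. K (fst p) (fst q) * L (snd p) (snd q))"
  unfolding pd_kernel_def
proof (intro conjI ballI allI impI)
  fix p q assume "p \<in> S \<times> T" "q \<in> S \<times> T"
  then show "cnj (K (fst p) (fst q) * L (snd p) (snd q)) = K (fst q) (fst p) * L (snd q) (snd p)"
    using pd_kernel_cnj[OF K, of "fst p" "fst q"] pd_kernel_cnj[OF L, of "snd p" "snd q"] by auto
next
  fix c :: "'a \<times> 'b \<Rightarrow> complex" assume "\<exists>p\<in>S \<times> T. c p \<noteq> 0"
  then obtain i k where ik: "i \<in> S" "k \<in> T" "c (i, k) \<noteq> 0" by auto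
  let ?V = "\<lambda>i k. c (i, k)"
  have "sesq (S \<times> T) (\<lambda>p q. K (fst p) (fst q) * L (snd p) (snd q)) c c =
    (\<Sum>i\<in>S. \<Sum>k\<in>T. \<Sum>j\<in>S. \<Sum>l\<in>T. K i j * (L k l * c (j, l) * cnj (c (i, k))))"
    unfolding sesq_def sum.cartesian_product'[symmetric]
    by (simp add: sum.cartesian_product' split_def mult_ac)
  also have "\<dots> = (\<Sum>i\<in>S. \<Sum>j\<in>S. \<Sum>k\<in>T. \<Sum>l\<in>T. K i j * (L k l * c (j, l) * cnj (c (i, k))))"
    by (intro sum.cong refl sum.swap)
  also have "\<dots> = (\<Sum>i\<in>S. \<Sum>j\<in>S. K i j * sesq T L (?V j) (?V i))"
    by (simp add: sesq_def sum_distrib_left)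
  finally show "Re (sesq (S \<times> T) (\<lambda>p q. K (fst p) (fst q) * L (snd p) (snd q)) c c) > 0"
    using pd_kernel_gram_pos[OF S K L ik(1,2), of ?V] ik(3) by simp
qed

section \<open>Midpoints, and the passage between kernels and matrices\<close>

lemma pd_kernel_add:
  assumes "pd_kernel S K" and "pd_kernel S L"
  shows "pd_kernel S (\<lambda>i j. K i j + L i j)"
proof -
  have "sesq S (\<lambda>i j. K i j + L i j) c c = sesq S K c c + sesq S L c c" for c
    by (simp add: sesq_def sum.distrib algebra_simps)
  with assms show ?thesis unfolding pd_kernel_def by (simp add: add_pos_pos)
qed

lemma pd_kernel_scale:
  assumes "pd_kernel S K" and "r > 0"
  shows "pd_kernel S (\<lambda>i j. of_real r * K i j)"
proof -
  have "sesq S (\<lambda>i j. of_real r * K i j) c c = of_real r * sesq S K c c" for c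
    by (simp add: sesq_def sum_distrib_left mult.assoc)
  with assms show ?thesis unfolding pd_kernel_def by simp
qed

text \<open>Every vector of dimension \<open>n\<close> is \<open>vec n c\<close> for some function
  \<open>c\<close>, nonzero exactly when \<open>c\<close> is nonzero somewhere below
  \<open>n\<close>; so the quantifiers over vectors and over functions agree.\<close>

lemma hermitian_pd_iff:
  "hermitian_pd n X \<longleftrightarrow> X \<in> carrier_mat n n \<and> pd_kernel {..<n} (\<lambda>i j. X $$ (i, j))"
proof (cases "X \<in> carrier_mat n n")
  case X: True
  have adj: "mat_adjoint X = X \<longleftrightarrow> (\<forall>i\<in>{..<n}. \<forall>j\<in>{..<n}. cnj (X $$ (i, j)) = X $$ (j, i))"
  proof -
    have "mat_adjoint X \<in> carrier_mat n n"
      using X by (auto simp: mat_adjoint_def)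
    moreover have "mat_adjoint X $$ (j, i) = cnj (X $$ (i, j))" if "i < n" "j < n" for i j
      using X that by (auto simp: mat_adjoint_def mat_of_rows_def)
    ultimately show ?thesis
      using X by (auto simp: mat_eq_iff)
  qed
  have form: "(X *\<^sub>v vec n c) \<bullet>c vec n c = sesq {..<n} (\<lambda>i j. X $$ (i, j)) c c" for c :: "nat \<Rightarrow> complex"
    using X by (simp add: scalar_prod_def sesq_def sum_distrib_right lessThan_atLeast0)
  have "(\<forall>v\<in>carrier_vec n. v \<noteq> 0\<^sub>v n \<longrightarrow> Re ((X *\<^sub>v v) \<bullet>c v) > 0) \<longleftrightarrow>
    (\<forall>c. (\<exists>i\<in>{..<n}. c i \<noteq> 0) \<longrightarrow> Re (sesq {..<n} (\<lambda>i j. X $$ (i, j)) c c) > 0)"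
    (is "?l \<longleftrightarrow> ?r")
  proof (intro iffI allI ballI impI)
    fix c :: "nat \<Rightarrow> complex" assume l: ?l and c: "\<exists>i\<in>{..<n}. c i \<noteq> 0"
    have "vec n c \<noteq> 0\<^sub>v n" using c by (auto simp: vec_eq_iff)
    with l show "Re (sesq {..<n} (\<lambda>i j. X $$ (i, j)) c c) > 0"
      unfolding form[symmetric] by simp
  next
    fix v :: "complex vec" assume r: ?r and v: "v \<in> carrier_vec n" "v \<noteq> 0\<^sub>v n"
    from v have "\<exists>i\<in>{..<n}. v $ i \<noteq> 0" by (auto simp: vec_eq_iff)
    moreover have "vec n (($) v) = v" using v by auto
    ultimately show "Re ((X *\<^sub>v v) \<bullet>c v) > 0" using r form[of "($) v"] by metis
  qed
  with X adj show ?thesis by (simp add: hermitian_pd_def pd_kernel_def)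
qed (simp add: hermitian_pd_def)

lemma hermitian_pd_carrier: "hermitian_pd n X \<Longrightarrow> X \<in> carrier_mat n n"
  by (simp add: hermitian_pd_def)

lemma hermitian_pd_kernel: "hermitian_pd n X \<Longrightarrow> pd_kernel {..<n} (\<lambda>i j. X $$ (i, j))"
  by (simp add: hermitian_pd_iff)

lemma hermitian_pd_midpoint:
  assumes "hermitian_pd n X" and "hermitian_pd n Y"
  shows "hermitian_pd n ((1/2) \<cdot>\<^sub>m (X + Y))"
proof -
  have "pd_kernel {..<n} (\<lambda>i j. of_real (1/2) * (X $$ (i, j) + Y $$ (i, j)))"
    by (rule pd_kernel_scale[OF pd_kernel_add[OF assms[THEN hermitian_pd_kernel]]]) simp
  then have "pd_kernel {..<n} (\<lambda>i j. ((1/2) \<cdot>\<^sub>m (X + Y)) $$ (i, j))"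
    by (rule pd_kernel_cong) (use assms[THEN hermitian_pd_carrier] in simp)
  then show ?thesis
    using assms[THEN hermitian_pd_carrier] by (simp add: hermitian_pd_iff)
qed

section \<open>Principal submatrices\<close>

definition principal_submat :: "nat \<Rightarrow> (nat \<Rightarrow> nat) \<Rightarrow> 'a mat \<Rightarrow> 'a mat" where
  "principal_submat m f X = mat m m (\<lambda>(i, j). X $$ (f i, f j))"

lemma hermitian_pd_principal:
  assumes "hermitian_pd n X" and "inj_on f {..<m}" and "f ` {..<m} \<subseteq> {..<n}"
  shows "hermitian_pd m (principal_submat m f X)"
proof -
  have "pd_kernel {..<m} (\<lambda>i j. X $$ (f i, f j))"
    using pd_kernel_reindex[OF hermitian_pd_kernel[OF assms(1)] _ assms(2,3)] by simp
  then have "pd_kernel {..<m} (\<lambda>i j. principal_submat m f X $$ (i, j))"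
    by (rule pd_kernel_cong) (simp add: principal_submat_def)
  then show ?thesis by (simp add: hermitian_pd_iff principal_submat_def)
qed

text \<open>\<open>insert_index k\<close> lists in order the indices other than
  \<open>k\<close>.\<close>

lemma mat_delete_eq_principal:
  assumes "X \<in> carrier_mat (Suc n) (Suc n)" and "k < Suc n"
  shows "mat_delete X k k = principal_submat n (insert_index k) X"
  using assms
  by (intro eq_matI) (simp_all add: principal_submat_def mat_delete_index[symmetric])

lemma hermitian_pd_mat_delete:
  assumes "hermitian_pd n X" and "k < n"
  shows "hermitian_pd (n - 1) (mat_delete X k k)"
proof -
  obtain m where n: "n = Suc m" using assms(2) by (cases n) auto
  note X = assms(1)[unfolded n] and k = assms(2)[unfolded n]
  have "hermitian_pd m (principal_submat m (insert_index k) X)"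
    using insert_index_image[OF k]
    by (intro hermitian_pd_principal[OF X] insert_index_inj_on) (auto simp: lessThan_atLeast0)
  then show ?thesis
    by (simp add: n mat_delete_eq_principal[OF hermitian_pd_carrier[OF X] k])
qed

section \<open>The adjugate and positivity of determinants\<close>

text \<open>Column \<open>k\<close> of the adjugate identity: \<open>X\<close> sends column
  \<open>k\<close> of \<open>adj_mat X\<close> to \<open>det X\<close> times a unit vector.\<close>

lemma adj_mat_col:
  assumes X: "X \<in> carrier_mat n n" and "i < n" "k < n"
  shows "(\<Sum>j<n. X $$ (i, j) * adj_mat X $$ (j, k)) = (if i = k then det X else 0)"
proof -
  have "(X * adj_mat X) $$ (i, k) = (\<Sum>j<n. X $$ (i, j) * adj_mat X $$ (j, k))"
    using assms adj_mat(1)[OF X] by (auto simp: scalar_prod_def lessThan_atLeast0)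
  moreover have "(X * adj_mat X) $$ (i, k) = (if i = k then det X else 0)"
    unfolding adj_mat(2)[OF X] using assms by simp
  ultimately show ?thesis by simp
qed

text \<open>The cofactor sign is \<open>(-1) ^ (k + k) = 1\<close>.\<close>

lemma adj_mat_diag:
  assumes "X \<in> carrier_mat n n" and "k < n"
  shows "adj_mat X $$ (k, k) = det (mat_delete X k k)"
  using assms by (simp add: adj_mat_def cofactor_def)

lemma sesq_unit_image:
  assumes "finite S" "k \<in> S" "\<And>i. i \<in> S \<Longrightarrow> (\<Sum>j\<in>S. K i j * w j) = (if i = k then s else 0)"
  shows "sesq S K w e = s * cnj (e k)"
proof -
  have "sesq S K w e = (\<Sum>i\<in>S. (if i = k then s else 0) * cnj (e i))"
    unfolding sesq_def sum_distrib_right[symmetric] using assms(3) by simp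
  also have "\<dots> = (\<Sum>i\<in>S. if i = k then s * cnj (e k) else 0)"
    by (intro sum.cong) auto
  finally show ?thesis using assms(1,2) by simp
qed

text \<open>Induction on the size, evaluating the form at column 0 of the adjugate: the value is
  \<open>det X\<close> times the positive determinant of a smaller positive definite matrix. It is
  real by Hermitian symmetry and positive by definiteness, hence so is \<open>det X\<close>.\<close>

lemma hermitian_pd_det:
  assumes "hermitian_pd n X"
  shows "Re (det X) > 0 \<and> Im (det X) = 0"
  using assms
proof (induction n arbitrary: X)
  case 0
  then show ?case using det_dim_zero[of X] by (simp add: hermitian_pd_def)
next
  case (Suc n)
  let ?K = "\<lambda>i j. X $$ (i, j)" and ?u = "\<lambda>j. adj_mat X $$ (j, 0)"
  note X = hermitian_pd_carrier[OF Suc.prems] and pd = hermitian_pd_kernel[OF Suc.prems]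
  have X0: "hermitian_pd n (mat_delete X 0 0)"
    using hermitian_pd_mat_delete[OF Suc.prems, of 0] by simp
  define d where "d = Re (det (mat_delete X 0 0))"
  have d: "d > 0" "?u 0 = of_real d"
    using Suc.IH[OF X0] adj_mat_diag[OF X, of 0]
    unfolding d_def complex_eq_iff by simp_all
  have s: "sesq {..<Suc n} ?K ?u ?u = det X * of_real d"
    using sesq_unit_image[of "{..<Suc n}" 0 ?K ?u "det X" ?u, OF _ _ adj_mat_col[OF X]] d(2)
    by (simp del: sum.lessThan_Suc)
  have "Re (sesq {..<Suc n} ?K ?u ?u) > 0"
    using pd_kernel_pos[OF pd, of 0 ?u] d by simp
  moreover have "Im (sesq {..<Suc n} ?K ?u ?u) = 0"
    using sesq_cnj[OF pd, of ?u ?u] by (simp add: complex_eq_iff)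
  ultimately show ?case using d(1) unfolding s by (simp add: zero_less_mult_iff)
qed

section \<open>Determinant ratios as constrained minima\<close>

text \<open>The condition on \<open>w\<close> is stationarity of the form on the hyperplane where
  coordinate \<open>k\<close> is 1. For \<open>c = w + e\<close> with \<open>e k = 0\<close> the
  cross terms vanish, leaving \<open>s\<close> plus the nonnegative value at
  \<open>e\<close>.\<close>

lemma sesq_ge_minimum:
  assumes pd: "pd_kernel S K" and S: "finite S" "k \<in> S"
    and w: "\<And>i. i \<in> S \<Longrightarrow> (\<Sum>j\<in>S. K i j * w j) = (if i = k then s else 0)" "w k = 1"
    and c: "c k = 1"
  shows "Re (sesq S K c c) \<ge> Re s"
proof -
  define e where "e i = c i - w i" for i
  have w_form: "sesq S K w d = s * cnj (d k)" for d
    using S w(1) by (intro sesq_unit_image)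
  have ek: "e k = 0" using w(2) c by (simp add: e_def)
  have "sesq S K c c = sesq S K (\<lambda>i. w i + e i) (\<lambda>i. w i + e i)" by (simp add: e_def)
  also have "\<dots> = s + sesq S K e w + sesq S K e e"
    unfolding sesq_add w_form using w(2) ek by simp
  also have "sesq S K e w = cnj (sesq S K w e)" using sesq_cnj[OF pd] by simp
  also have "\<dots> = 0" unfolding w_form using ek by simp
  finally show ?thesis using pd_kernel_nonneg[OF pd, of e] by simp
qed

text \<open>For positive definite \<open>X\<close> and a valid index \<open>k\<close> this is the
  reciprocal of diagonal entry \<open>k\<close> of the inverse. Both determinants are then real, so
  \<open>Re\<close> loses nothing.\<close>

definition det_ratio :: "nat \<Rightarrow> complex mat \<Rightarrow> real" where
  "det_ratio k X = Re (det X) / Re (det (mat_delete X k k))"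

lemma det_ratio_pos:
  assumes "hermitian_pd n X" and "k < n"
  shows "det_ratio k X > 0"
  using hermitian_pd_det[OF assms(1)] hermitian_pd_det[OF hermitian_pd_mat_delete[OF assms]]
  by (simp add: det_ratio_def)

text \<open>The witness is column \<open>k\<close> of the adjugate divided by its own entry at
  \<open>k\<close>, which is the nonzero determinant of the remaining submatrix.\<close>

lemma det_ratio_witness:
  assumes pd: "hermitian_pd n X" and k: "k < n"
  obtains w where "w k = 1"
    "\<And>i. i < n \<Longrightarrow>
      (\<Sum>j<n. X $$ (i, j) * w j) = (if i = k then of_real (det_ratio k X) else 0)"
proof -
  note X = hermitian_pd_carrier[OF pd]
  note dX = hermitian_pd_det[OF pd] and dk = hermitian_pd_det[OF hermitian_pd_mat_delete[OF assms]]
  let ?d = "det (mat_delete X k k)"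
  define w where "w j = adj_mat X $$ (j, k) / ?d" for j
  have d0: "?d \<noteq> 0" using dk by auto
  have r: "of_real (det_ratio k X) = det X / ?d"
  proof -
    have "of_real (Re (det X)) = det X" "of_real (Re ?d) = ?d"
      using dX dk by (auto simp: complex_eq_iff)
    then show ?thesis by (simp add: det_ratio_def)
  qed
  show thesis
  proof (rule that)
    show "w k = 1" using d0 adj_mat_diag[OF X k] by (simp add: w_def)
    fix i assume "i < n"
    from adj_mat_col[OF X this k]
    show "(\<Sum>j<n. X $$ (i, j) * w j) = (if i = k then of_real (det_ratio k X) else 0)"
      unfolding w_def r times_divide_eq_right sum_divide_distrib[symmetric] by simp
  qed
qed

text \<open>The minimiser \<open>w\<close> for the midpoint has coordinate \<open>k\<close> equal to
  1, so the forms of \<open>X\<close> and \<open>Y\<close> at \<open>w\<close> bound both ratios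
  from above. By linearity of the form in the matrix, their mean is the ratio at the
  midpoint.\<close>

lemma det_ratio_midpoint:
  assumes X: "hermitian_pd n X" and Y: "hermitian_pd n Y" and k: "k < n"
  shows "(det_ratio k X + det_ratio k Y) / 2 \<le> det_ratio k ((1/2) \<cdot>\<^sub>m (X + Y))"
proof -
  let ?Z = "(1/2) \<cdot>\<^sub>m (X + Y)" and ?S = "{..<n}"
  have kS: "finite ?S" "k \<in> ?S" using k by auto
  obtain w where w: "w k = 1" "\<And>i. i < n \<Longrightarrow>
      (\<Sum>j<n. ?Z $$ (i, j) * w j) = (if i = k then of_real (det_ratio k ?Z) else 0)"
    using det_ratio_witness[OF hermitian_pd_midpoint[OF X Y] k] by metis
  have lower: "det_ratio k M \<le> Re (sesq ?S (\<lambda>i j. M $$ (i, j)) w w)"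
    if M: "hermitian_pd n M" for M
  proof -
    obtain v where v: "v k = 1" "\<And>i. i < n \<Longrightarrow>
      (\<Sum>j<n. M $$ (i, j) * v j) = (if i = k then of_real (det_ratio k M) else 0)"
      using det_ratio_witness[OF M k] by metis
    have "Re (of_real (det_ratio k M)) \<le> Re (sesq ?S (\<lambda>i j. M $$ (i, j)) w w)"
      by (rule sesq_ge_minimum[where w = v, OF hermitian_pd_kernel[OF M] kS])
        (simp_all add: v w(1))
    then show ?thesis by simp
  qed
  have "sesq ?S (\<lambda>i j. ?Z $$ (i, j)) w w =
    (1/2) * (sesq ?S (\<lambda>i j. X $$ (i, j)) w w + sesq ?S (\<lambda>i j. Y $$ (i, j)) w w)"
    unfolding sesq_def sum.distrib[symmetric] sum_distrib_left
    using hermitian_pd_carrier[OF X] hermitian_pd_carrier[OF Y]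
    by (intro sum.cong refl) (simp add: algebra_simps)
  moreover have "sesq ?S (\<lambda>i j. ?Z $$ (i, j)) w w = of_real (det_ratio k ?Z)"
    using sesq_unit_image[OF kS, of "\<lambda>i j. ?Z $$ (i, j)" w "of_real (det_ratio k ?Z)" w] w by simp
  ultimately have "of_real (det_ratio k ?Z) =
    (1/2) * (sesq ?S (\<lambda>i j. X $$ (i, j)) w w + sesq ?S (\<lambda>i j. Y $$ (i, j)) w w)" by simp
  from arg_cong[OF this, of Re] show ?thesis using lower[OF X] lower[OF Y] by simp
qed

section \<open>Monotonicity of \<open>delta_S_sq\<close> under deletion of indices\<close>

lemma delta_S_sq_eq:
  assumes X: "hermitian_pd n X" and Y: "hermitian_pd n Y"
  shows "delta_S_sq X Y =
    ln (Re (det ((1/2) \<cdot>\<^sub>m (X + Y)))) - (ln (Re (det X)) + ln (Re (det Y))) / 2"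
  using hermitian_pd_det[OF X] hermitian_pd_det[OF Y]
    det_mult[OF hermitian_pd_carrier[OF X] hermitian_pd_carrier[OF Y]]
  by (simp add: delta_S_sq_def ln_mult)

text \<open>The right side minus the left is \<open>ln\<close> of the ratio at the midpoint minus
  the mean of \<open>ln\<close> of the ratios at \<open>X\<close> and \<open>Y\<close>.\<close>

lemma delta_S_sq_mat_delete:
  assumes X: "hermitian_pd n X" and Y: "hermitian_pd n Y" and k: "k < n"
  shows "delta_S_sq (mat_delete X k k) (mat_delete Y k k) \<le> delta_S_sq X Y"
proof -
  let ?Z = "(1/2) \<cdot>\<^sub>m (X + Y)"
  note Z = hermitian_pd_midpoint[OF X Y]
  \<comment> \<open>Deletion commutes with taking the midpoint, so \<open>det_ratio k ?Z\<close>
    compares the two midpoint determinants.\<close>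
  have Zk: "(1/2) \<cdot>\<^sub>m (mat_delete X k k + mat_delete Y k k) = mat_delete ?Z k k"
    using hermitian_pd_carrier[OF X] hermitian_pd_carrier[OF Y] k
    by (intro eq_matI) (auto simp: mat_delete_def)
  have ln_ratio: "ln (det_ratio k M) = ln (Re (det M)) - ln (Re (det (mat_delete M k k)))"
    if "hermitian_pd n M" for M
    using hermitian_pd_det[OF that] hermitian_pd_det[OF hermitian_pd_mat_delete[OF that k]]
    by (simp add: det_ratio_def ln_div)
  note pos = det_ratio_pos[OF X k] det_ratio_pos[OF Y k] det_ratio_pos[OF Z k]
  have "sqrt (det_ratio k X * det_ratio k Y) \<le> det_ratio k ?Z"
    using arith_geo_mean_sqrt[of "det_ratio k X" "det_ratio k Y"] det_ratio_midpoint[OF X Y k] pos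
    by simp
  then have "ln (sqrt (det_ratio k X * det_ratio k Y)) \<le> ln (det_ratio k ?Z)"
    using pos by simp
  then have "(ln (det_ratio k X) + ln (det_ratio k Y)) / 2 \<le> ln (det_ratio k ?Z)"
    using pos by (simp add: ln_sqrt ln_mult)
  then show ?thesis
    unfolding ln_ratio[OF X] ln_ratio[OF Y] ln_ratio[OF Z] delta_S_sq_eq[OF X Y] Zk
      delta_S_sq_eq[OF hermitian_pd_mat_delete[OF X k] hermitian_pd_mat_delete[OF Y k]]
    by (simp add: field_simps)
qed

text \<open>Induction on \<open>n\<close>: if the selection omits some \<open>k\<close>, that index
  is deleted first; if it hits every index, strict monotonicity forces \<open>f\<close> to be the
  identity.\<close>

lemma delta_S_sq_principal:
  assumes "hermitian_pd n X" and "hermitian_pd n Y"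
    and "strict_mono_on {..<m} f" and "f ` {..<m} \<subseteq> {..<n}"
  shows "delta_S_sq (principal_submat m f X) (principal_submat m f Y) \<le> delta_S_sq X Y"
  using assms
proof (induction n arbitrary: X Y f)
  case 0
  then have "m = 0" by auto
  with 0 have "principal_submat m f X = X" "principal_submat m f Y = Y"
    by (auto simp: principal_submat_def hermitian_pd_def)
  then show ?case by simp
next
  case (Suc n)
  note XY = Suc.prems(1,2)[THEN hermitian_pd_carrier]
  have inj: "inj_on f {..<m}" using Suc.prems(3) by (rule strict_mono_on_imp_inj_on)
  show ?case
  proof (cases "f ` {..<m} = {..<Suc n}")
    case True
    have m: "m = Suc n" using card_image[OF inj] True by simp
    have "map f [0..<m] = [0..<m]"
    proof (rule sorted_distinct_set_unique)
      show "sorted (map f [0..<m])"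
        using strict_mono_on_leD[OF Suc.prems(3)] by (simp add: sorted_iff_nth_mono)
      show "distinct (map f [0..<m])"
        using inj by (simp add: distinct_map lessThan_atLeast0)
      show "set (map f [0..<m]) = set [0..<m]"
        using True unfolding m[symmetric] by (simp add: lessThan_atLeast0)
    qed simp_all
    then have "f i = i" if "i < m" for i
      using that by (simp add: list_eq_iff_nth_eq)
    then have "principal_submat m f X = X" "principal_submat m f Y = Y"
      using XY m by (auto simp: principal_submat_def)
    then show ?thesis by simp
  next
    case False
    with Suc.prems(4) obtain k where k: "k < Suc n" "k \<notin> f ` {..<m}" by blast
    \<comment> \<open>This is \<open>f\<close> in the numbering after deletion of \<open>k\<close>;
      \<open>insert_index k\<close> recovers \<open>f\<close>, as \<open>k\<close> is never one of
      its values.\<close>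
    define g where "g i = delete_index k (f i)" for i
    have fg: "insert_index k (g i) = f i" if "i < m" for i
      using k(2) that by (auto simp: g_def intro!: insert_delete_index)
    have gn: "g i < n" if "i < m" for i
    proof -
      have "f i < Suc n" "f i \<noteq> k" using that k(2) Suc.prems(4) by auto
      with k(1) show ?thesis by (auto simp: g_def delete_index_def)
    qed
    have mono: "strict_mono_on {..<m} g"
    proof (rule strict_mono_onI)
      fix i j assume ij: "i \<in> {..<m}" "j \<in> {..<m}" "i < j"
      then have "f i < f j" "f i \<noteq> k" "f j \<noteq> k"
        using strict_mono_onD[OF Suc.prems(3)] k(2) by auto
      \<comment> \<open>\<open>delete_index k\<close> is strictly increasing once \<open>k\<close>
        itself is avoided.\<close>
      then show "g i < g j" by (auto simp: g_def delete_index_def)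
    qed
    have eq: "principal_submat m g (mat_delete M k k) = principal_submat m f M"
      if "M \<in> carrier_mat (Suc n) (Suc n)" for M :: "complex mat"
      unfolding mat_delete_eq_principal[OF that k(1)]
      by (intro eq_matI) (simp_all add: principal_submat_def gn fg)
    have "delta_S_sq (principal_submat m g (mat_delete X k k)) (principal_submat m g (mat_delete Y k k))
      \<le> delta_S_sq (mat_delete X k k) (mat_delete Y k k)"
      using gn hermitian_pd_mat_delete[OF _ k(1)] Suc.prems(1,2)
      by (intro Suc.IH mono) auto
    also have "\<dots> \<le> delta_S_sq X Y"
      by (rule delta_S_sq_mat_delete[OF Suc.prems(1,2) k(1)])
    finally show ?thesis unfolding eq[OF XY(1)] eq[OF XY(2)] .
  qed
qed

section \<open>Kronecker and Hadamard products\<close>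

text \<open>Division with remainder by \<open>n\<close> turns indices below \<open>m * n\<close>
  into pairs, so the tensor kernel pulls back to the Kronecker product.\<close>

lemma hermitian_pd_kronecker:
  assumes A: "hermitian_pd m A" and B: "hermitian_pd n B"
  shows "hermitian_pd (m * n) (A \<otimes>\<^sub>K B)"
proof -
  note AB = hermitian_pd_carrier[OF A] hermitian_pd_carrier[OF B]
  let ?f = "\<lambda>i. (i div n, i mod n)"
  have inj: "inj_on ?f {..<m * n}"
    by (rule inj_onI) (metis div_mult_mod_eq prod.inject)
  \<comment> \<open>An element of \<open>{..<m * n}\<close> can exist only if \<open>n > 0\<close>,
    and this bounds the remainder.\<close>
  have im: "?f ` {..<m * n} \<subseteq> {..<m} \<times> {..<n}"
    by (auto simp: less_mult_imp_div_less) (metis mod_less_divisor mult_0_right not_gr_zero not_less_zero)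
  have "pd_kernel {..<m * n} (\<lambda>i j. A $$ (i div n, j div n) * B $$ (i mod n, j mod n))"
    using pd_kernel_reindex[OF pd_kernel_tensor[OF _ hermitian_pd_kernel[OF A] hermitian_pd_kernel[OF B]]
        _ inj im] by simp
  then have "pd_kernel {..<m * n} (\<lambda>i j. (A \<otimes>\<^sub>K B) $$ (i, j))"
    by (rule pd_kernel_cong) (use AB in \<open>simp add: kronecker_prod_def\<close>)
  then show ?thesis using AB by (simp add: hermitian_pd_iff kronecker_prod_def)
qed

lemma diag_index_less:
  assumes "i < (n :: nat)"
  shows "i * n + i < n * n"
proof -
  have "i * n + i < Suc i * n" using assms by simp
  also have "\<dots> \<le> n * n" using assms by (intro mult_le_mono1) simp
  finally show ?thesis .
qed

text \<open>For \<open>i < n\<close>, quotient and remainder of \<open>i * n + i\<close> by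
  \<open>n\<close> are both \<open>i\<close>.\<close>

lemma hadamard_eq_principal_kronecker:
  assumes "A \<in> carrier_mat n n" and "B \<in> carrier_mat n n"
  shows "A \<circ>\<^sub>H B = principal_submat n (\<lambda>i. i * n + i) (A \<otimes>\<^sub>K B)"
  using assms diag_index_less[of _ n]
  by (intro eq_matI) (auto simp: hadamard_prod_def principal_submat_def kronecker_prod_def)

theorem corollary4p16:
  fixes n :: nat and A B C D :: "complex mat"
  assumes "hermitian_pd n A" and "hermitian_pd n B"
    and "hermitian_pd n C" and "hermitian_pd n D"
  shows "delta_S_sq (A \<circ>\<^sub>H B) (C \<circ>\<^sub>H D) \<le> delta_S_sq (A \<otimes>\<^sub>K B) (C \<otimes>\<^sub>K D)"
proof -
  note car = assms[THEN hermitian_pd_carrier]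
  show ?thesis
    unfolding hadamard_eq_principal_kronecker[OF car(1,2)] hadamard_eq_principal_kronecker[OF car(3,4)]
  \<comment> \<open>The same index map selects both Hadamard products, so the two sides are compared
    by a single principal selection.\<close>
  proof (rule delta_S_sq_principal)
    show "hermitian_pd (n * n) (A \<otimes>\<^sub>K B)" "hermitian_pd (n * n) (C \<otimes>\<^sub>K D)"
      using assms by (auto intro: hermitian_pd_kronecker)
    show "strict_mono_on {..<n} (\<lambda>i. i * n + i)"
      by (intro strict_mono_onI add_le_less_mono mult_le_mono1) auto
    show "(\<lambda>i. i * n + i) ` {..<n} \<subseteq> {..<n * n}"
      using diag_index_less by auto
  qed
qed

end
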